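(* Let $\Omega\subset\mathbb{R}^3$ be a non-empty, connected open set and let $\bm{H}\colon\Omega\to\mathbb{R}^3$ be a continuously differentiable vector field satisfying $\nabla\cdot\bm{H}=0$ and $\nabla\times\bm{H}=0$ on $\Omega$. Then no level set of $\bm{H}$, i.e. no set of the form $\{\bm{x}\in\Omega : \bm{H}(\bm{x})=\bm{c}\}$ with $\bm{c}\in\mathbb{R}^3$, is a $2$-dimensional regular surface in $\Omega$.
   Context: A $2$-dimensional regular surface $\mathcal{S}\subset\Omega$ is a (embedded) $C^1$ submanifold of dimension $2$, i.e. locally the image of a $C^1$ parametrization $\varphi(\tau,\sigma)$ with linearly independent partial derivatives, so that the tangent space at every point is $2$-dimensional. *)

theory Defs
  imports "HOL-Analysis.Analysis"
begin

text \<open>Continuously differentiable (C^1) maps on an open set U: Frechet differentiable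
  at every point of U, with every directional derivative depending continuously on the
  point (in finite dimensions this is continuity of the derivative).\<close>
definition C1_on :: "('a::euclidean_space) set \<Rightarrow> ('a \<Rightarrow> 'b::euclidean_space) \<Rightarrow> bool" where
  "C1_on U f \<longleftrightarrow> (\<forall>x\<in>U. f differentiable (at x)) \<and>
     (\<forall>v. continuous_on U (\<lambda>x. frechet_derivative f (at x) v))"

definition pd :: "(real^3 \<Rightarrow> real^3) \<Rightarrow> 3 \<Rightarrow> 3 \<Rightarrow> real^3 \<Rightarrow> real" where
  "pd H i j x = (frechet_derivative H (at x) (axis j 1)) $ i"

definition div3 :: "(real^3 \<Rightarrow> real^3) \<Rightarrow> real^3 \<Rightarrow> real" where
  "div3 H x = pd H 1 1 x + pd H 2 2 x + pd H 3 3 x"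

definition curl3 :: "(real^3 \<Rightarrow> real^3) \<Rightarrow> real^3 \<Rightarrow> real^3" where
  "curl3 H x = vector [pd H 3 2 x - pd H 2 3 x, pd H 1 3 x - pd H 3 1 x, pd H 2 1 x - pd H 1 2 x]"

definition regular_surface_in :: "(real^3) set \<Rightarrow> (real^3) set \<Rightarrow> bool" where
  "regular_surface_in \<Omega> S \<longleftrightarrow> S \<noteq> {} \<and> S \<subseteq> \<Omega> \<and>
     (\<forall>p\<in>S. \<exists>V U (\<phi>::real^2 \<Rightarrow> real^3) \<psi>.
        open V \<and> p \<in> V \<and> open U \<and> C1_on U \<phi> \<and>
        homeomorphism U (S \<inter> V) \<phi> \<psi> \<and>
        (\<forall>u\<in>U. \<forall>a b::real.
            a *\<^sub>R frechet_derivative \<phi> (at u) (axis 1 1)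
          + b *\<^sub>R frechet_derivative \<phi> (at u) (axis 2 1) = 0 \<longrightarrow> a = 0 \<and> b = 0))"

end

theory Submission
  imports Defs
begin

text \<open>Put $F = H - c$. Its derivative is symmetric (zero curl) and traceless (zero divergence).
  If $F$ vanishes on a surface, then $DF$ kills the two-dimensional tangent space, so by symmetry it
  is a multiple of $n n^T$ with $n$ the normal, and zero trace forces $DF = 0$ on the surface.
  Averaging against a radial bump gives a mean value property, from which every directional
  derivative of $F$ is again a continuously differentiable field with symmetric traceless
  derivative; hence, iterating, all derivatives of $F$ vanish on the surface. The Cauchy estimates
  coming from the mean value property make the Taylor remainder tend to zero, so $F$ vanishes near
  each point of the surface. The level set then contains a ball, whereas the image of a
  differentiable map from the plane is a null set.\<close>

section \<open>Integration by parts for compactly supported functions\<close>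

text \<open>The integral of a translate $f(x + t v)$ does not depend on $t$; differentiate at $t = 0$.\<close>
lemma integral_directional_derivative_compact_support:
  fixes f :: "'a::euclidean_space \<Rightarrow> 'b::euclidean_space"
  assumes der: "\<And>x. (f has_derivative f' x) (at x)"
    and cont: "continuous_on UNIV (\<lambda>x. f' x v)"
    and supp: "\<And>x. x \<notin> cbox a b \<Longrightarrow> f x = 0"
  shows "integral (cbox a b) (\<lambda>x. f' x v) = 0"
proof -
  have contf: "continuous_on UNIV f"
    using der by (meson continuous_at_imp_continuous_on has_derivative_continuous)
  \<comment> \<open>\<open>K\<close> is swept out by the box as it is translated along
    \<open>v\<close>. A single box \<open>cbox c d\<close> around \<open>K\<close> serves as
    integration domain for all translates, so that the Leibniz rule applies with a domain
    independent of \<open>t\<close>.\<close>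
  define K where "K = (\<lambda>(t, x). x - t *\<^sub>R v) ` ({-1..1::real} \<times> cbox a b)"
  have "compact K"
    unfolding K_def by (intro compact_continuous_image compact_Times continuous_intros)
       (auto simp: case_prod_unfold intro!: continuous_intros)
  then obtain c d where cd: "K \<subseteq> cbox c d"
    by (meson bounded_subset_cbox_symmetric compact_imp_bounded)
  have sub: "cbox (a - t *\<^sub>R v) (b - t *\<^sub>R v) \<subseteq> cbox c d" if "t \<in> {-1<..<1}" for t
  proof
    fix x assume "x \<in> cbox (a - t *\<^sub>R v) (b - t *\<^sub>R v)"
    then have "x + t *\<^sub>R v \<in> cbox a b"
      by (auto simp: mem_box inner_diff_left inner_add_left algebra_simps)
    then have "x \<in> K" unfolding K_def
      using that by (auto intro!: image_eqI[of _ _ "(t, x + t *\<^sub>R v)"])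
    then show "x \<in> cbox c d" using cd by blast
  qed
  have const: "integral (cbox c d) (\<lambda>x. f (x + t *\<^sub>R v)) = integral (cbox a b) f"
    if t: "t \<in> {-1<..<1}" for t
  proof -
    have "(\<lambda>x. f (x + t *\<^sub>R v)) integrable_on cbox (a - t *\<^sub>R v) (b - t *\<^sub>R v)"
      by (intro integrable_continuous continuous_intros continuous_on_compose2[OF contf]) auto
    then have "((\<lambda>x. f (x + t *\<^sub>R v)) has_integral integral (cbox a b) f)
        (cbox (a - t *\<^sub>R v) (b - t *\<^sub>R v))"
      using integral_shift_cbox[of a "t *\<^sub>R v" b f] by (metis integrable_integral)
    then have "((\<lambda>x. f (x + t *\<^sub>R v)) has_integral integral (cbox a b) f) (cbox c d)"
    proof (rule has_integral_on_superset)
      fix x assume "x \<notin> cbox (a - t *\<^sub>R v) (b - t *\<^sub>R v)"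
      then have "x + t *\<^sub>R v \<notin> cbox a b"
        by (auto simp: mem_box inner_diff_left inner_add_left algebra_simps)
      then show "f (x + t *\<^sub>R v) = 0" by (rule supp)
    qed (rule sub[OF t])
    then show ?thesis by (rule integral_unique)
  qed
  have "((\<lambda>t. integral (cbox c d) (\<lambda>x. f (x + t *\<^sub>R v))) has_vector_derivative
      integral (cbox c d) (\<lambda>x. f' (x + 0 *\<^sub>R v) v)) (at 0 within {-1<..<1::real})"
  proof (rule leibniz_rule_vector_derivative)
    fix t :: real and x
    have "((\<lambda>t. f (x + t *\<^sub>R v)) has_derivative (\<lambda>s. f' (x + t *\<^sub>R v) (s *\<^sub>R v)))
        (at t within {-1<..<1})"
      by (rule has_derivative_compose[OF _ der]) (auto intro!: derivative_eq_intros)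
    moreover have "f' (x + t *\<^sub>R v) (s *\<^sub>R v) = s *\<^sub>R f' (x + t *\<^sub>R v) v" for s
      using der[of "x + t *\<^sub>R v"] by (metis has_derivative_linear linear_cmul)
    ultimately show "((\<lambda>t. f (x + t *\<^sub>R v)) has_vector_derivative f' (x + t *\<^sub>R v) v)
        (at t within {-1<..<1})"
      by (simp add: has_vector_derivative_def)
  next
    fix t :: real
    show "(\<lambda>x. f (x + t *\<^sub>R v)) integrable_on cbox c d"
      by (intro integrable_continuous continuous_intros continuous_on_compose2[OF contf]) auto
  next
    show "continuous_on ({-1<..<1} \<times> cbox c d) (\<lambda>(t, x). f' (x + t *\<^sub>R v) v)"
      unfolding case_prod_unfold
      by (intro continuous_intros continuous_on_compose2[OF cont]) auto
  qed auto
  then have "((\<lambda>t::real. integral (cbox a b) f) has_vector_derivative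
      integral (cbox c d) (\<lambda>x. f' (x + 0 *\<^sub>R v) v)) (at 0 within {-1<..<1})"
    by (rule has_vector_derivative_transform[rotated 2]) (auto simp: const)
  moreover have "at 0 within {-1<..<1::real} = at 0" by (rule at_within_open) auto
  ultimately have "((\<lambda>t::real. integral (cbox a b) f) has_vector_derivative
      integral (cbox c d) (\<lambda>x. f' x v)) (at 0)"
    by (simp only: scaleR_zero_left add_0_right)
  from vector_derivative_unique_at[OF this has_vector_derivative_const]
  have zero: "integral (cbox c d) (\<lambda>x. f' x v) = 0" .
  \<comment> \<open>The complement of the box is open and \<open>f\<close> vanishes on it, so the
    derivative vanishes there too; this brings the integral over \<open>cbox c d\<close> back to
    \<open>cbox a b\<close>.\<close>
  have supp': "f' x v = 0" if "x \<notin> cbox a b" for x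
  proof -
    have "((\<lambda>_. 0) has_derivative f' x) (at x)"
      by (rule has_derivative_transform_within_open[OF der, of "- cbox a b"])
         (use that supp in \<open>auto intro: closed_cbox\<close>)
    then have "f' x = (\<lambda>_. 0)"
      by (rule has_derivative_unique) (rule has_derivative_const)
    then show ?thesis by simp
  qed
  have "(\<lambda>x. f' x v) integrable_on cbox a b"
    by (intro integrable_continuous continuous_on_subset[OF cont]) auto
  then have "((\<lambda>x. f' x v) has_integral integral (cbox a b) (\<lambda>x. f' x v)) (cbox c d)"
    using sub[of 0] by (intro has_integral_on_superset[OF integrable_integral] supp') auto
  then show ?thesis using zero by (simp add: integral_unique)
qed

text \<open>The product of \<open>k\<close> and \<open>G\<close>, extended by 0 outside
  \<open>W\<close>, is differentiable everywhere, because \<open>W\<close> and the complement of the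
  box are open sets covering the space. The integral of its derivative along \<open>v\<close> is 0
  by the preceding lemma.\<close>

lemma integration_by_parts_compact_support:
  fixes G :: "'a::euclidean_space \<Rightarrow> 'b::euclidean_space"
  assumes k: "\<And>z. (k has_derivative k' z) (at z)"
    and contk: "continuous_on UNIV (\<lambda>z. k' z v)"
    and supp: "\<And>z. z \<notin> cbox a b \<Longrightarrow> k z = 0"
    and W: "open W" "cbox a b \<subseteq> W"
    and G: "\<And>z. z \<in> W \<Longrightarrow> (G has_derivative G' z) (at z)"
    and contG: "continuous_on W (\<lambda>z. G' z v)"
  shows "integral (cbox a b) (\<lambda>z. k' z v *\<^sub>R G z + k z *\<^sub>R G' z v) = 0"
proof -
  define f where "f z = (if z \<in> W then k z *\<^sub>R G z else 0)" for z
  define f' where "f' z h = (if z \<in> W then k' z h *\<^sub>R G z + k z *\<^sub>R G' z h else 0)" for z h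
  have off: "(f has_derivative (\<lambda>_. 0)) (at z)" if "z \<notin> cbox a b" for z
    by (rule has_derivative_transform_within_open[OF has_derivative_const[of 0 "at z"], of "- cbox a b"])
       (use that supp in \<open>auto simp: f_def intro: closed_cbox\<close>)
  have on: "(f has_derivative f' z) (at z)" if "z \<in> W" for z
  proof -
    have "((\<lambda>z. k z *\<^sub>R G z) has_derivative f' z) (at z)"
      using that by (auto intro!: derivative_eq_intros k G simp: f'_def add.commute)
    then show ?thesis
      by (rule has_derivative_transform_within_open[OF _ W(1) that]) (auto simp: f_def)
  qed
  have der: "(f has_derivative f' z) (at z)" for z
  proof (cases "z \<in> W")
    case False
    with off[of z] W(2) show ?thesis by (auto simp: f'_def[abs_def])
  qed (rule on)
  have f'0: "f' z = (\<lambda>_. 0)" if "z \<notin> cbox a b" for z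
    using has_derivative_unique[OF der off[OF that]] .
  have cG: "continuous_on W G"
    using G by (meson continuous_at_imp_continuous_on has_derivative_continuous)
  have ck: "continuous_on UNIV k"
    using k by (meson continuous_at_imp_continuous_on has_derivative_continuous)
  have "continuous_on W (\<lambda>z. k' z v *\<^sub>R G z + k z *\<^sub>R G' z v)"
    by (intro continuous_intros cG contG continuous_on_subset[OF ck] continuous_on_subset[OF contk]) auto
  then have 1: "continuous_on W (\<lambda>z. f' z v)"
    by (rule continuous_on_eq) (simp add: f'_def)
  have 2: "continuous_on (- cbox a b) (\<lambda>z. f' z v)"
    by (rule continuous_on_eq[of _ "\<lambda>_. 0"]) (auto simp: f'0)
  have "continuous_on (W \<union> - cbox a b) (\<lambda>z. f' z v)"
    by (intro continuous_on_open_Un 1 2 W) (auto intro: closed_cbox)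
  moreover have "W \<union> - cbox a b = UNIV" using W by auto
  ultimately have "integral (cbox a b) (\<lambda>z. f' z v) = 0"
    using W(2) supp by (intro integral_directional_derivative_compact_support[OF der]) (auto simp: f_def)
  moreover have "integral (cbox a b) (\<lambda>z. f' z v)
      = integral (cbox a b) (\<lambda>z. k' z v *\<^sub>R G z + k z *\<^sub>R G' z v)"
    using W(2) by (intro integral_cong) (auto simp: f'_def)
  ultimately show ?thesis by simp
qed

section \<open>A radial bump function\<close>

text \<open>Squaring the positive part makes the function continuously differentiable across the
  unit sphere, which is all the smoothness used below. Dependence on \<open>z \<bullet> z\<close>
  alone makes the gradient at \<open>z\<close> a multiple of \<open>z\<close>.\<close>

definition bump :: "'a::euclidean_space \<Rightarrow> real" where
  "bump z = (max 0 (1 - z \<bullet> z))\<^sup>2"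

definition bump_deriv :: "'a::euclidean_space \<Rightarrow> 'a \<Rightarrow> real" where
  "bump_deriv z h = - 4 * max 0 (1 - z \<bullet> z) * (z \<bullet> h)"

text \<open>A box rather than a ball, since the integrals are taken over \<open>cbox\<close>; it
  contains the unit ball, outside which \<open>bump\<close> is 0. Its points have norm up to
  \<open>DIM('a)\<close>, hence the factors \<open>DIM('a)\<close> in the radii below.\<close>

abbreviation unit_box :: "'a::euclidean_space set" where
  "unit_box \<equiv> cbox (- One) One"

lemma norm_unit_box_le:
  fixes z :: "'a::euclidean_space"
  assumes "z \<in> unit_box"
  shows "norm z \<le> DIM('a)"
proof -
  have "norm z \<le> (\<Sum>b\<in>Basis. \<bar>z \<bullet> b\<bar>)" by (rule norm_le_l1)
  also have "\<dots> \<le> (\<Sum>b\<in>(Basis::'a set). 1)"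
    using assms by (intro sum_mono) (auto simp: mem_box abs_le_iff minus_le_iff)
  finally show ?thesis by simp
qed

lemma bump_outside_unit_box: "z \<notin> unit_box \<Longrightarrow> bump z = 0"
proof -
  assume "z \<notin> unit_box"
  then obtain b where b: "b \<in> Basis" "\<bar>z \<bullet> b\<bar> > 1"
    by (force simp: mem_box)
  have "\<bar>z \<bullet> b\<bar> \<le> norm z" using b(1) by (rule Basis_le_norm)
  with b have "norm z > 1" by simp
  then have "z \<bullet> z > 1" by (simp add: dot_square_norm one_less_power)
  then show ?thesis by (simp add: bump_def)
qed

text \<open>Squaring flattens the kink: at 0 the difference quotient is at most
  \<open>\<bar>h\<bar>\<close> in absolute value.\<close>

lemma has_real_derivative_positive_part_square:
  "((\<lambda>s::real. (max 0 s)\<^sup>2) has_real_derivative 2 * max 0 s) (at s)"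
proof (cases s "0::real" rule: linorder_cases)
  case less
  have "((\<lambda>s::real. 0) has_real_derivative 2 * max 0 s) (at s)"
    using less by auto
  then show ?thesis
    by (rule has_field_derivative_transform_within_open[of _ _ _ "{..<0}"]) (use less in auto)
next
  case equal
  have "((\<lambda>h::real. (max 0 h)\<^sup>2 / h) \<longlongrightarrow> 0) (at 0)"
  proof (rule Lim_null_comparison)
    show "\<forall>\<^sub>F h in at 0. norm ((max 0 h)\<^sup>2 / h) \<le> \<bar>h::real\<bar>"
      by (intro always_eventually) (auto simp: max_def power2_eq_square)
    show "((\<lambda>h::real. \<bar>h\<bar>) \<longlongrightarrow> 0) (at 0)"
      by (intro tendsto_eq_intros) auto
  qed
  with equal show ?thesis by (simp add: DERIV_def)
next
  case greater
  have "((\<lambda>s::real. s\<^sup>2) has_real_derivative 2 * max 0 s) (at s)"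
    using greater by (auto intro!: derivative_eq_intros)
  then show ?thesis
    by (rule has_field_derivative_transform_within_open[of _ _ _ "{0<..}"]) (use greater in auto)
qed

lemma has_derivative_bump: "(bump has_derivative bump_deriv z) (at z)"
proof -
  have "((\<lambda>z::'a. 1 - z \<bullet> z) has_derivative (\<lambda>h. - 2 * (z \<bullet> h))) (at z)"
    by (auto intro!: derivative_eq_intros simp: inner_commute)
  from has_derivative_compose[OF this,
      OF has_real_derivative_positive_part_square[unfolded has_field_derivative_def]]
  show ?thesis by (simp add: bump_def[abs_def] bump_deriv_def[abs_def] mult_ac)
qed

lemma continuous_on_bump [continuous_intros]:
  "continuous_on S f \<Longrightarrow> continuous_on S (\<lambda>x. bump (f x))"
  unfolding bump_def by (intro continuous_intros)

lemma continuous_on_bump_deriv [continuous_intros]: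
  "continuous_on S f \<Longrightarrow> continuous_on S g \<Longrightarrow> continuous_on S (\<lambda>x. bump_deriv (f x) (g x))"
  unfolding bump_deriv_def by (intro continuous_intros)

lemma integral_bump_pos: "integral unit_box (bump :: 'a::euclidean_space \<Rightarrow> real) > 0"
proof -
  have c: "continuous_on unit_box (bump :: 'a \<Rightarrow> real)"
    by (intro continuous_intros)
  have "integral unit_box (bump :: 'a \<Rightarrow> real) \<ge> 0"
    by (intro integral_nonneg integrable_continuous c) (simp add: bump_def)
  moreover have "integral unit_box (bump :: 'a \<Rightarrow> real) \<noteq> 0"
  proof -
    have "(0::'a) \<in> unit_box" "bump (0::'a) \<noteq> 0" by (auto simp: mem_box bump_def)
    moreover have "box (- One) (One::'a) \<noteq> {}" by (auto simp: box_ne_empty)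
    ultimately show ?thesis
      using integral_cbox_eq_0_iff[OF c] by (auto simp: bump_def)
  qed
  ultimately show ?thesis by simp
qed

lemma abs_bump_deriv_le: "\<bar>bump_deriv z v\<bar> \<le> 4 * norm v"
proof (cases "norm z \<le> 1")
  case True
  have "\<bar>bump_deriv z v\<bar> = 4 * (max 0 (1 - z \<bullet> z) * \<bar>z \<bullet> v\<bar>)"
    by (simp add: bump_deriv_def abs_mult)
  also have "max 0 (1 - z \<bullet> z) * \<bar>z \<bullet> v\<bar> \<le> 1 * (1 * norm v)"
    using True Cauchy_Schwarz_ineq2[of z v] mult_right_mono[OF True, of "norm v"]
    by (intro mult_mono) auto
  finally show ?thesis by simp
next
  case False
  then have "1 - z \<bullet> z \<le> 0" by (simp add: dot_square_norm)
  then show ?thesis by (simp add: bump_deriv_def max_def)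
qed

section \<open>Symmetric traceless derivatives and the mean value property\<close>

text \<open>Locally these are gradients of harmonic functions: symmetry gives a potential, and the
  trace is its Laplacian. The derivative takes values in the bounded linear maps so that it can be
  integrated and its continuity stated in the operator norm.\<close>

definition laplace_field ::
  "'a::euclidean_space set \<Rightarrow> ('a \<Rightarrow> 'a) \<Rightarrow> ('a \<Rightarrow> 'a \<Rightarrow>\<^sub>L 'a) \<Rightarrow> bool" where
  "laplace_field U F F' \<longleftrightarrow>
     (\<forall>x\<in>U. (F has_derivative F' x) (at x)) \<and> continuous_on U F' \<and>
     (\<forall>x\<in>U. \<forall>u w. F' x u \<bullet> w = u \<bullet> F' x w) \<and>
     (\<forall>x\<in>U. (\<Sum>b\<in>Basis. F' x b \<bullet> b) = 0)"

lemma laplace_field_continuous_on: "laplace_field U F F' \<Longrightarrow> continuous_on U F"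
  unfolding laplace_field_def
  by (meson continuous_at_imp_continuous_on has_derivative_continuous)

lemma scaled_unit_box_subset:
  fixes y :: "'a::euclidean_space" and r s :: real
  assumes "cball y (real DIM('a) * r) \<subseteq> U" "0 \<le> s" "s \<le> r" "z \<in> unit_box"
  shows "y + s *\<^sub>R z \<in> U"
proof -
  have "s * norm z \<le> r * DIM('a)"
    using assms norm_unit_box_le[of z] by (intro mult_mono) auto
  then have "y + s *\<^sub>R z \<in> cball y (real DIM('a) * r)"
    using assms(2) by (simp add: dist_norm mult.commute)
  with assms(1) show ?thesis by blast
qed

lemma has_derivative_bump_times_coordinate:
  "((\<lambda>z. bump z * (z \<bullet> j)) has_derivative (\<lambda>h. bump_deriv z h * (z \<bullet> j) + bump z * (h \<bullet> j))) (at z)"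
  by (auto intro!: derivative_eq_intros has_derivative_bump)

text \<open>The left-hand side is the radius derivative of the bump average of $F \<bullet> b$. Moving the derivative
  from direction $b$ to direction $j$ by two integrations by parts turns it into a multiple of the trace,
  because the derivatives of the bump times a coordinate are symmetric in the two directions.\<close>
lemma laplace_field_radial_moment_zero:
  fixes F :: "'a::euclidean_space \<Rightarrow> 'a" and F' :: "'a \<Rightarrow> 'a \<Rightarrow>\<^sub>L 'a"
  assumes F: "laplace_field U F F'" and U: "open U" and "s > 0"
    and sub: "\<And>z. z \<in> unit_box \<Longrightarrow> y + s *\<^sub>R z \<in> U" and b: "b \<in> Basis"
  shows "integral unit_box (\<lambda>z. bump z * (F' (y + s *\<^sub>R z) z \<bullet> b)) = 0"
proof -
  define W where "W = (\<lambda>z. y + s *\<^sub>R z) -` U"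
  have W: "open W" "unit_box \<subseteq> W"
    using sub unfolding W_def by (auto intro!: continuous_open_vimage U continuous_intros)
  have F': "continuous_on U F'" and der: "\<And>x. x \<in> U \<Longrightarrow> (F has_derivative F' x) (at x)"
    and sym: "\<And>x u w. x \<in> U \<Longrightarrow> F' x u \<bullet> w = u \<bullet> F' x w"
    and tr: "\<And>x. x \<in> U \<Longrightarrow> (\<Sum>b\<in>Basis. F' x b \<bullet> b) = 0"
    using F by (auto simp: laplace_field_def)
  have cF': "continuous_on W (\<lambda>z. F' (y + s *\<^sub>R z))"
    by (rule continuous_on_compose2[OF F']) (auto simp: W_def intro!: continuous_intros)
  have cF: "continuous_on W (\<lambda>z. F (y + s *\<^sub>R z))"
    by (rule continuous_on_compose2[OF laplace_field_continuous_on[OF F]])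
       (auto simp: W_def intro!: continuous_intros)
  note cont = continuous_on_subset[OF cF' W(2)] continuous_on_subset[OF cF W(2)]
  have G: "((\<lambda>z. F (y + s *\<^sub>R z) \<bullet> j) has_derivative (\<lambda>h. s * (F' (y + s *\<^sub>R z) h \<bullet> j))) (at z)"
    if "z \<in> W" for z j
  proof -
    have "((\<lambda>z. y + s *\<^sub>R z) has_derivative (\<lambda>h. s *\<^sub>R h)) (at z)"
      by (auto intro!: derivative_eq_intros)
    from has_derivative_compose[OF this der] that
    have "((\<lambda>z. F (y + s *\<^sub>R z)) has_derivative (\<lambda>h. F' (y + s *\<^sub>R z) (s *\<^sub>R h))) (at z)"
      by (auto simp: W_def)
    from has_derivative_inner_left[OF this, of j] show ?thesis
      by (simp add: blinfun.scaleR_right)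
  qed
  have parts: "((\<lambda>z. (bump_deriv z v * (z \<bullet> i) + bump z * (v \<bullet> i)) * (F (y + s *\<^sub>R z) \<bullet> j)
        + bump z * (z \<bullet> i) * (s * (F' (y + s *\<^sub>R z) v \<bullet> j))) has_integral 0) unit_box"
    (is "(?f has_integral 0) unit_box") for i j v
  proof -
    have "?f integrable_on unit_box"
      by (intro integrable_continuous continuous_intros cont)
    moreover have "integral unit_box ?f = 0"
    proof -
      have "integral unit_box (\<lambda>z. (bump_deriv z v * (z \<bullet> i) + bump z * (v \<bullet> i)) *\<^sub>R (F (y + s *\<^sub>R z) \<bullet> j)
        + (bump z * (z \<bullet> i)) *\<^sub>R (s * (F' (y + s *\<^sub>R z) v \<bullet> j))) = 0"
        by (rule integration_by_parts_compact_support[where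
              k = "\<lambda>z. bump z * (z \<bullet> i)" and k' = "\<lambda>z h. bump_deriv z h * (z \<bullet> i) + bump z * (h \<bullet> i)" and
              G = "\<lambda>z. F (y + s *\<^sub>R z) \<bullet> j" and G' = "\<lambda>z h. s * (F' (y + s *\<^sub>R z) h \<bullet> j)" and v = v,
              OF has_derivative_bump_times_coordinate _ _ W G])
           (auto intro!: continuous_intros cF' simp: bump_outside_unit_box)
      then show ?thesis by simp
    qed
    ultimately show ?thesis unfolding has_integral_iff by (rule conjI)
  qed
  have swap: "((\<lambda>z. s * (bump z * ((z \<bullet> j) * (F' (y + s *\<^sub>R z) b \<bullet> j))
      - bump z * ((z \<bullet> b) * (F' (y + s *\<^sub>R z) j \<bullet> j)))) has_integral 0) unit_box" for j
    using has_integral_diff[OF parts[of b j j] parts[of j b j]]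
    by (simp add: bump_deriv_def algebra_simps inner_commute)
  have "((\<lambda>z. \<Sum>j\<in>Basis. s * (bump z * ((z \<bullet> j) * (F' (y + s *\<^sub>R z) b \<bullet> j))
      - bump z * ((z \<bullet> b) * (F' (y + s *\<^sub>R z) j \<bullet> j)))) has_integral (\<Sum>j\<in>(Basis::'a set). 0)) unit_box"
    by (intro has_integral_sum swap) auto
  then have *: "((\<lambda>z. \<Sum>j\<in>Basis. s * (bump z * ((z \<bullet> j) * (F' (y + s *\<^sub>R z) b \<bullet> j))
      - bump z * ((z \<bullet> b) * (F' (y + s *\<^sub>R z) j \<bullet> j)))) has_integral 0) unit_box"
    by simp
  have "((\<lambda>z. s * (bump z * (F' (y + s *\<^sub>R z) z \<bullet> b))) has_integral 0) unit_box"
  proof (rule has_integral_eq[OF _ *])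
    fix z :: 'a assume "z \<in> unit_box"
    then have z: "y + s *\<^sub>R z \<in> U" using W by (auto simp: W_def)
    \<comment> \<open>Summing over \<open>j\<close> assembles \<open>z \<bullet> F' b\<close> from
      the first terms, which symmetry turns into \<open>F' z \<bullet> b\<close>, and the trace from
      the second ones, which is 0.\<close>
    have "(\<Sum>j\<in>Basis. s * (bump z * ((z \<bullet> j) * (F' (y + s *\<^sub>R z) b \<bullet> j))
      - bump z * ((z \<bullet> b) * (F' (y + s *\<^sub>R z) j \<bullet> j))))
      = s * (bump z * (\<Sum>j\<in>Basis. (z \<bullet> j) * (F' (y + s *\<^sub>R z) b \<bullet> j))
          - bump z * ((z \<bullet> b) * (\<Sum>j\<in>Basis. F' (y + s *\<^sub>R z) j \<bullet> j)))"
      by (simp add: sum_distrib_left sum_subtractf right_diff_distrib)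
    also have "(\<Sum>j\<in>Basis. (z \<bullet> j) * (F' (y + s *\<^sub>R z) b \<bullet> j)) = z \<bullet> F' (y + s *\<^sub>R z) b"
      by (rule euclidean_inner[symmetric])
    finally show "(\<Sum>j\<in>Basis. s * (bump z * ((z \<bullet> j) * (F' (y + s *\<^sub>R z) b \<bullet> j))
      - bump z * ((z \<bullet> b) * (F' (y + s *\<^sub>R z) j \<bullet> j)))) = s * (bump z * (F' (y + s *\<^sub>R z) z \<bullet> b))"
      unfolding tr[OF z] sym[OF z, of z b] by (simp only: mult_zero_right diff_zero)
  qed
  from has_integral_mult_right[OF this, of "1/s"] \<open>s > 0\<close> show ?thesis
    by (simp add: integral_unique)
qed

text \<open>The bump average has zero derivative in the radius by the preceding lemma, so it equals
  its value at radius 0, where the integrand is \<open>bump z\<close> times the constant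
  \<open>F y\<close>.\<close>

lemma laplace_field_mean_value:
  fixes F :: "'a::euclidean_space \<Rightarrow> 'a" and F' :: "'a \<Rightarrow> 'a \<Rightarrow>\<^sub>L 'a" and r :: real
  assumes F: "laplace_field U F F'" and U: "open U" and r: "r > 0"
    and sub: "cball y (real DIM('a) * r) \<subseteq> U"
  shows "integral unit_box (\<lambda>z. bump z *\<^sub>R F (y + r *\<^sub>R z)) = integral unit_box (bump :: 'a \<Rightarrow> real) *\<^sub>R F y"
proof -
  have F': "continuous_on U F'" and der: "\<And>x. x \<in> U \<Longrightarrow> (F has_derivative F' x) (at x)"
    using F by (auto simp: laplace_field_def)
  note cF = laplace_field_continuous_on[OF F]
  have inU: "y + s *\<^sub>R z \<in> U" if "s \<in> {0..r}" "z \<in> unit_box" for s z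
    using scaled_unit_box_subset[OF sub] that by auto
  have cont: "continuous_on unit_box (\<lambda>z. F (y + s *\<^sub>R z))" if "s \<in> {0..r}" for s
    using inU[OF that] by (intro continuous_on_compose2[OF cF] continuous_intros) auto
  have int: "(\<lambda>z. bump z *\<^sub>R F (y + s *\<^sub>R z)) integrable_on unit_box" if "s \<in> {0..r}" for s
    by (intro integrable_continuous continuous_intros cont that)
  have eq: "integral unit_box (\<lambda>z. bump z * (F (y + r *\<^sub>R z) \<bullet> b))
      = integral unit_box (\<lambda>z. bump z * (F (y + 0 *\<^sub>R z) \<bullet> b))" if b: "b \<in> Basis" for b
  proof -
    define m where "m s = integral unit_box (\<lambda>z. bump z * (F (y + s *\<^sub>R z) \<bullet> b))" for s
    have m': "(m has_real_derivative integral unit_box (\<lambda>z. bump z * (F' (y + s *\<^sub>R z) z \<bullet> b)))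
        (at s within {0..r})" if s: "s \<in> {0..r}" for s
      unfolding m_def[abs_def]
    proof (rule leibniz_rule_field_derivative[OF _ _ _ s])
      fix t and z :: 'a assume t: "t \<in> {0..r}" and z: "z \<in> unit_box"
      have "((\<lambda>t. y + t *\<^sub>R z) has_derivative (\<lambda>h. h *\<^sub>R z)) (at t within {0..r})"
        by (auto intro!: derivative_eq_intros)
      from has_derivative_compose[OF this der[OF inU[OF t z]]]
      have "((\<lambda>t. F (y + t *\<^sub>R z)) has_derivative (\<lambda>h. F' (y + t *\<^sub>R z) (h *\<^sub>R z))) (at t within {0..r})" .
      from has_derivative_mult_right[OF has_derivative_inner_left[OF this, of b], of "bump z"]
      show "((\<lambda>t. bump z * (F (y + t *\<^sub>R z) \<bullet> b)) has_real_derivative bump z * (F' (y + t *\<^sub>R z) z \<bullet> b))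
          (at t within {0..r})"
        unfolding has_field_derivative_def
        by (rule has_derivative_eq_rhs) (simp add: fun_eq_iff blinfun.scaleR_right)
    next
      fix t assume "t \<in> {0..r}"
      then show "(\<lambda>z. bump z * (F (y + t *\<^sub>R z) \<bullet> b)) integrable_on unit_box"
        by (intro integrable_continuous continuous_intros cont)
    next
      show "continuous_on ({0..r} \<times> unit_box) (\<lambda>(t, z). bump z * (F' (y + t *\<^sub>R z) z \<bullet> b))"
        unfolding case_prod_unfold using inU
        by (intro continuous_intros continuous_on_compose2[OF F']) auto
    qed auto
    have "m r = m 0"
    \<comment> \<open>The radial moment is known to vanish only for positive radius; at the endpoint
      0 continuity of \<open>m\<close> suffices.\<close>
    proof (rule DERIV_isconst_end[OF r])
      show "continuous_on {0..r} m"
        using m' by (meson DERIV_continuous continuous_on_eq_continuous_within)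
    next
      fix s assume s: "0 < s" "s < r"
      then have "integral unit_box (\<lambda>z. bump z * (F' (y + s *\<^sub>R z) z \<bullet> b)) = 0"
        by (intro laplace_field_radial_moment_zero[OF F U s(1) _ b] inU) auto
      with m'[of s] s show "(m has_real_derivative 0) (at s)"
        by (simp add: at_within_Icc_at)
    qed
    then show ?thesis unfolding m_def .
  qed
  show ?thesis
  proof (rule euclidean_eqI)
    fix b :: 'a assume b: "b \<in> Basis"
    have "integral unit_box (\<lambda>z. bump z *\<^sub>R F (y + r *\<^sub>R z)) \<bullet> b
        = integral unit_box (\<lambda>z. bump z * (F (y + r *\<^sub>R z) \<bullet> b))"
      using integral_component_eq[OF int, of r b] r by simp
    also have "\<dots> = integral unit_box (\<lambda>z::'a. bump z *\<^sub>R (F y \<bullet> b))"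
      using eq[OF b] by simp
    also have "\<dots> = (integral unit_box (bump :: 'a \<Rightarrow> real) *\<^sub>R F y) \<bullet> b"
      by simp
    finally show "integral unit_box (\<lambda>z. bump z *\<^sub>R F (y + r *\<^sub>R z)) \<bullet> b
        = (integral unit_box (bump :: 'a \<Rightarrow> real) *\<^sub>R F y) \<bullet> b" .
  qed
qed

section \<open>Derivatives as averages and the Cauchy estimate\<close>

text \<open>Differentiation under the integral sign. The weight \<open>k\<close> is left general
  because the lemma serves twice: with \<open>bump\<close>, to differentiate the mean value
  identity, and with a multiple of \<open>bump_deriv\<close>, to differentiate the formula for
  \<open>F'\<close> obtained from it.\<close>

lemma has_derivative_weighted_average:
  fixes F :: "'a::euclidean_space \<Rightarrow> 'a" and F' :: "'a \<Rightarrow> 'a \<Rightarrow>\<^sub>L 'a" and r R :: real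
  assumes F: "laplace_field U F F'" and k: "continuous_on unit_box k"
    and r: "r > 0" "real DIM('a) * r < R" and sub: "ball y R \<subseteq> U"
  shows "((\<lambda>x. integral unit_box (\<lambda>z. k z *\<^sub>R F (x + r *\<^sub>R z))) has_derivative
      blinfun_apply (integral unit_box (\<lambda>z. k z *\<^sub>R F' (y + r *\<^sub>R z)))) (at y)"
proof -
  have F': "continuous_on U F'" and der: "\<And>x. x \<in> U \<Longrightarrow> (F has_derivative F' x) (at x)"
    using F by (auto simp: laplace_field_def)
  note cF = laplace_field_continuous_on[OF F]
  \<comment> \<open>The averages use points at distance at most \<open>DIM('a) * r\<close> from the
    centre, so \<open>e\<close> is the distance by which the centre may move without leaving
    \<open>ball y R\<close>.\<close>
  define e where "e = R - real DIM('a) * r"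
  have e: "e > 0" using r by (simp add: e_def)
  have inU: "x + r *\<^sub>R z \<in> U" if x: "x \<in> ball y e" and z: "z \<in> unit_box" for x z
  proof (rule scaled_unit_box_subset[of _ r])
    have "dist y w < R" if "dist x w \<le> real DIM('a) * r" for w
      using x that dist_triangle[of y w x] unfolding e_def by simp
    then show "cball x (real DIM('a) * r) \<subseteq> U" using sub by auto
  qed (use r z in auto)
  have "((\<lambda>x. integral unit_box (\<lambda>z. k z *\<^sub>R F (x + r *\<^sub>R z))) has_derivative
      blinfun_apply (integral unit_box (\<lambda>z. k z *\<^sub>R F' (y + r *\<^sub>R z)))) (at y within ball y e)"
  proof (rule leibniz_rule)
    fix x z :: 'a assume x: "x \<in> ball y e" and z: "z \<in> unit_box"
    have "((\<lambda>x. x + r *\<^sub>R z) has_derivative (\<lambda>h. h)) (at x within ball y e)"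
      by (auto intro!: derivative_eq_intros)
    from has_derivative_compose[OF this der[OF inU[OF x z]]]
    have "((\<lambda>x. F (x + r *\<^sub>R z)) has_derivative F' (x + r *\<^sub>R z)) (at x within ball y e)" .
    from has_derivative_scaleR_right[OF this, of "k z"]
    show "((\<lambda>x. k z *\<^sub>R F (x + r *\<^sub>R z)) has_derivative (k z *\<^sub>R F' (x + r *\<^sub>R z))) (at x within ball y e)"
      by (simp add: blinfun.scaleR_left[abs_def])
  next
    fix x assume x: "x \<in> ball y e"
    show "(\<lambda>z. k z *\<^sub>R F (x + r *\<^sub>R z)) integrable_on unit_box"
      using inU[OF x] by (intro integrable_continuous continuous_intros k continuous_on_compose2[OF cF]) auto
  next
    show "continuous_on (ball y e \<times> unit_box) (\<lambda>(x, z). k z *\<^sub>R F' (x + r *\<^sub>R z))"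
      unfolding case_prod_unfold using inU
      by (intro continuous_intros continuous_on_compose2[OF F'] continuous_on_compose2[OF k]) auto
  qed (use e in auto)
  then show ?thesis using e at_within_open[of y "ball y e"] by simp
qed

text \<open>Differentiating the mean value identity expresses \<open>F' y v\<close> as a bump
  average of \<open>F'\<close>; integration by parts then moves the derivative onto the bump. The
  result involves only values of \<open>F\<close>, with a weight independent of
  \<open>y\<close>.\<close>

lemma laplace_field_derivative_formula:
  fixes F :: "'a::euclidean_space \<Rightarrow> 'a" and F' :: "'a \<Rightarrow> 'a \<Rightarrow>\<^sub>L 'a" and r R :: real
  assumes F: "laplace_field U F F'" and U: "open U"
    and r: "r > 0" "real DIM('a) * r < R" and sub: "ball y R \<subseteq> U"
  shows "blinfun_apply (F' y) v = (- 1 / (r * integral unit_box (bump :: 'a \<Rightarrow> real))) *\<^sub>R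
      integral unit_box (\<lambda>z. bump_deriv z v *\<^sub>R F (y + r *\<^sub>R z))"
proof -
  define c where "c = integral unit_box (bump :: 'a \<Rightarrow> real)"
  have c: "c > 0" unfolding c_def by (rule integral_bump_pos)
  have F': "continuous_on U F'" and der: "\<And>x. x \<in> U \<Longrightarrow> (F has_derivative F' x) (at x)"
    using F by (auto simp: laplace_field_def)
  note cF = laplace_field_continuous_on[OF F]
  have cball: "cball x (real DIM('a) * r) \<subseteq> U" if x: "x \<in> ball y (R - real DIM('a) * r)" for x
  proof -
    have "dist y w < R" if "dist x w \<le> real DIM('a) * r" for w
      using x that dist_triangle[of y w x] by simp
    then show ?thesis using sub by auto
  qed
  have yb: "y \<in> ball y (R - real DIM('a) * r)" using r by simp
  have inU: "y + r *\<^sub>R z \<in> U" if "z \<in> unit_box" for z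
    using scaled_unit_box_subset[OF cball[OF yb]] r that by auto
  \<comment> \<open>The mean value identity holds at every centre near \<open>y\<close>, so the
    average and \<open>c\<close> times \<open>F\<close> agree on a neighbourhood and share their
    derivative at \<open>y\<close>.\<close>
  have "((\<lambda>x. c *\<^sub>R F x) has_derivative
      blinfun_apply (integral unit_box (\<lambda>z. bump z *\<^sub>R F' (y + r *\<^sub>R z)))) (at y)"
  proof (rule has_derivative_transform_within_open[OF has_derivative_weighted_average[OF F _ r sub]])
    fix x assume "x \<in> ball y (R - real DIM('a) * r)"
    then show "integral unit_box (\<lambda>z. bump z *\<^sub>R F (x + r *\<^sub>R z)) = c *\<^sub>R F x"
      unfolding c_def by (intro laplace_field_mean_value[OF F U r(1)] cball)
  qed (use yb in \<open>auto intro!: continuous_intros\<close>)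
  from has_derivative_unique[OF _ this, of "\<lambda>h. c *\<^sub>R F' y h"]
  have "(\<lambda>h. c *\<^sub>R F' y h) = blinfun_apply (integral unit_box (\<lambda>z. bump z *\<^sub>R F' (y + r *\<^sub>R z)))"
    using inU[of 0] by (auto simp: mem_box intro!: has_derivative_scaleR_right der)
  then have "c *\<^sub>R F' y v = blinfun_apply (integral unit_box (\<lambda>z. bump z *\<^sub>R F' (y + r *\<^sub>R z))) v"
    by (rule fun_cong)
  also have intF': "(\<lambda>z. bump z *\<^sub>R F' (y + r *\<^sub>R z)) integrable_on unit_box"
    using inU by (intro integrable_continuous continuous_intros continuous_on_compose2[OF F']) auto
  have "blinfun_apply (integral unit_box (\<lambda>z. bump z *\<^sub>R F' (y + r *\<^sub>R z))) v
      = integral unit_box (\<lambda>z. bump z *\<^sub>R F' (y + r *\<^sub>R z) v)"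
    using blinfun_apply_integral[OF intF', of v] by (simp add: blinfun.scaleR_left)
  finally have 1: "c *\<^sub>R F' y v = integral unit_box (\<lambda>z. bump z *\<^sub>R F' (y + r *\<^sub>R z) v)" .
  define W where "W = (\<lambda>z. y + r *\<^sub>R z) -` U"
  have W: "open W" "unit_box \<subseteq> W"
    using inU unfolding W_def by (auto intro!: continuous_open_vimage U continuous_intros)
  have "integral unit_box (\<lambda>z. bump_deriv z v *\<^sub>R F (y + r *\<^sub>R z)
      + bump z *\<^sub>R (r *\<^sub>R F' (y + r *\<^sub>R z) v)) = 0"
  proof (rule integration_by_parts_compact_support[OF has_derivative_bump _ _ W])
    fix z assume "z \<in> W"
    then have z: "y + r *\<^sub>R z \<in> U" by (simp add: W_def)
    have "((\<lambda>z. y + r *\<^sub>R z) has_derivative (\<lambda>h. r *\<^sub>R h)) (at z)"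
      by (auto intro!: derivative_eq_intros)
    from has_derivative_compose[OF this der[OF z]]
    show "((\<lambda>z. F (y + r *\<^sub>R z)) has_derivative (\<lambda>h. r *\<^sub>R F' (y + r *\<^sub>R z) h)) (at z)"
      by (simp add: blinfun.scaleR_right)
  next
    show "continuous_on W (\<lambda>z. r *\<^sub>R F' (y + r *\<^sub>R z) v)"
      by (intro continuous_intros continuous_on_compose2[OF F']) (auto simp: W_def)
  qed (auto simp: bump_outside_unit_box intro!: continuous_intros)
  moreover have "(\<lambda>z. bump_deriv z v *\<^sub>R F (y + r *\<^sub>R z)) integrable_on unit_box"
    using inU by (intro integrable_continuous continuous_intros continuous_on_compose2[OF cF]) auto
  moreover have "(\<lambda>z. bump z *\<^sub>R (r *\<^sub>R F' (y + r *\<^sub>R z) v)) integrable_on unit_box"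
    using inU by (intro integrable_continuous continuous_intros continuous_on_compose2[OF F']) auto
  ultimately have "integral unit_box (\<lambda>z. bump_deriv z v *\<^sub>R F (y + r *\<^sub>R z))
      = - integral unit_box (\<lambda>z. bump z *\<^sub>R (r *\<^sub>R F' (y + r *\<^sub>R z) v))"
    by (simp add: integral_add add_eq_0_iff2)
  also have "\<dots> = - (r *\<^sub>R integral unit_box (\<lambda>z. bump z *\<^sub>R F' (y + r *\<^sub>R z) v))"
    by (subst integral_cmul[symmetric]) (simp add: mult.commute)
  finally have "integral unit_box (\<lambda>z. bump_deriv z v *\<^sub>R F (y + r *\<^sub>R z)) = - (r *\<^sub>R c *\<^sub>R F' y v)"
    using 1 by simp
  then show ?thesis using r c by (simp add: c_def)
qed

text \<open>The 8 is the 4 from the bound on \<open>bump_deriv\<close> times the 2 from the scale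
  \<open>R / (2 * DIM('a))\<close> used in the estimate below. The argument only carries the type,
  since the constant depends on the dimension alone.\<close>

definition cauchy_constant :: "'a::euclidean_space itself \<Rightarrow> real" where
  "cauchy_constant _ = 8 * DIM('a) * measure lborel (unit_box :: 'a set)
     / integral unit_box (bump :: 'a \<Rightarrow> real)"

lemma cauchy_constant_pos: "cauchy_constant TYPE('a::euclidean_space) > 0"
proof -
  have "measure lborel (unit_box :: 'a set) > 0" by (subst content_pos_lt_eq) auto
  then show ?thesis
    unfolding cauchy_constant_def using integral_bump_pos[where 'a = 'a] by simp
qed

text \<open>The Cauchy estimate: the integrand of the derivative formula is bounded by
  \<open>4 * norm v * M\<close>, and the prefactor contributes 1/\<open>R\<close>.\<close>

lemma laplace_field_derivative_bound:
  fixes F :: "'a::euclidean_space \<Rightarrow> 'a" and F' :: "'a \<Rightarrow> 'a \<Rightarrow>\<^sub>L 'a"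
  assumes F: "laplace_field U F F'" and U: "open U" and R: "R > 0" and sub: "ball y R \<subseteq> U"
    and M: "\<And>x. x \<in> ball y R \<Longrightarrow> norm (F x) \<le> M"
  shows "norm (F' y v) \<le> cauchy_constant TYPE('a) * norm v / R * M"
proof -
  define c where "c = integral unit_box (bump :: 'a \<Rightarrow> real)"
  have c: "c > 0" unfolding c_def by (rule integral_bump_pos)
  define q where "q = measure lborel (unit_box :: 'a set)"
  define r where "r = R / (2 * DIM('a))"
  have r: "r > 0" "real DIM('a) * r < R" using R by (auto simp: r_def)
  have M0: "M \<ge> 0" using R by (intro order_trans[OF norm_ge_zero M[of y]]) simp
  have inb: "y + r *\<^sub>R z \<in> ball y R" if "z \<in> unit_box" for z
    using r that by (intro scaled_unit_box_subset[of _ r]) auto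
  have "norm (integral unit_box (\<lambda>z. bump_deriv z v *\<^sub>R F (y + r *\<^sub>R z)))
      \<le> (4 * norm v * M) * q"
    unfolding q_def
  proof (rule integrable_bound)
    show "(\<lambda>z. bump_deriv z v *\<^sub>R F (y + r *\<^sub>R z)) integrable_on unit_box"
      using inb sub by (intro integrable_continuous continuous_intros
        continuous_on_compose2[OF laplace_field_continuous_on[OF F]]) auto
    show "norm (bump_deriv z v *\<^sub>R F (y + r *\<^sub>R z)) \<le> 4 * norm v * M" if "z \<in> unit_box" for z
      using M[OF inb[OF that]] abs_bump_deriv_le[of z v] by (auto intro!: mult_mono)
  qed (use M0 in auto)
  then have "norm (F' y v) \<le> (1 / (r * c)) * (4 * norm v * M * q)"
    using r c unfolding laplace_field_derivative_formula[OF F U r sub] c_def[symmetric]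
    by (simp add: divide_right_mono)
  also have "\<dots> = cauchy_constant TYPE('a) * norm v / R * M"
    by (simp add: cauchy_constant_def c_def q_def r_def field_simps)
  finally show ?thesis .
qed

section \<open>Higher derivatives\<close>

text \<open>A derivative at an interior point is unique, so the local derivative fields agree with
  one globally chosen field. Gluing is needed because the averaging radius in the next lemma depends
  on the point.\<close>

lemma laplace_field_glue:
  fixes F :: "'a::euclidean_space \<Rightarrow> 'a"
  assumes "\<And>y. y \<in> U \<Longrightarrow> \<exists>e>0. \<exists>F'. laplace_field (ball y e) F F'"
  shows "\<exists>F'. laplace_field U F F'"
proof -
  define F' where "F' x = (SOME A :: 'a \<Rightarrow>\<^sub>L 'a. (F has_derivative A) (at x))" for x
  have eq: "F' x = A" if "(F has_derivative blinfun_apply A) (at x)" for x A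
  proof -
    have "(F has_derivative F' x) (at x)"
      unfolding F'_def using that by (rule someI)
    with that have "blinfun_apply (F' x) = blinfun_apply A" by (metis has_derivative_unique)
    then show ?thesis by (simp add: blinfun_apply_inject)
  qed
  have loc: "\<exists>e>0. laplace_field (ball y e) F F'" if y: "y \<in> U" for y
  proof -
    obtain e G where e: "e > 0" and G: "laplace_field (ball y e) F G"
      using assms[OF y] by blast
    have FG: "F' x = G x" if "x \<in> ball y e" for x
      using G that by (intro eq) (auto simp: laplace_field_def)
    have "continuous_on (ball y e) G" using G by (simp add: laplace_field_def)
    then have "continuous_on (ball y e) F'"
      by (rule continuous_on_eq) (simp add: FG)
    with FG have "laplace_field (ball y e) F F'"
      using G unfolding laplace_field_def by auto
    with e show ?thesis by blast
  qed
  have "isCont F' y" if y: "y \<in> U" for y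
  proof -
    obtain e where "e > 0" "laplace_field (ball y e) F F'" using loc[OF y] by blast
    then show ?thesis
      by (metis centre_in_ball continuous_on_eq_continuous_at laplace_field_def open_ball)
  qed
  then have "continuous_on U F'" by (simp add: continuous_at_imp_continuous_on)
  moreover have "y \<in> ball y e" if "e > 0" for y and e :: real using that by simp
  ultimately have "laplace_field U F F'"
    using loc unfolding laplace_field_def by blast
  then show ?thesis by blast
qed

text \<open>Near each point \<open>F' x v\<close> is an average of \<open>F\<close> with a fixed
  weight, hence differentiable, and its derivative is the same average of \<open>F'\<close>.
  Symmetry and zero trace are linear conditions and pass to the average.\<close>

lemma laplace_field_directional_derivative:
  fixes F :: "'a::euclidean_space \<Rightarrow> 'a" and F' :: "'a \<Rightarrow> 'a \<Rightarrow>\<^sub>L 'a"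
  assumes F: "laplace_field U F F'" and U: "open U"
  shows "\<exists>G'. laplace_field U (\<lambda>x. F' x v) G'"
proof (rule laplace_field_glue)
  fix y assume "y \<in> U"
  then obtain R where R: "R > 0" and sub: "ball y R \<subseteq> U"
    using U open_contains_ball by blast
  have F': "continuous_on U F'"
    and sym: "\<And>x u w. x \<in> U \<Longrightarrow> F' x u \<bullet> w = u \<bullet> F' x w"
    and tr: "\<And>x. x \<in> U \<Longrightarrow> (\<Sum>b\<in>Basis. F' x b \<bullet> b) = 0"
    using F by (auto simp: laplace_field_def)
  \<comment> \<open>With this choice \<open>DIM('a) * r\<close> is \<open>R / 4\<close>, so the
    derivative formula on balls of radius \<open>R / 2\<close> holds with one and the same
    \<open>r\<close> at every \<open>x\<close> in \<open>ball y (R/2)\<close>.\<close>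
  define r where "r = R / (4 * DIM('a))"
  have r: "r > 0" "real DIM('a) * r < R / 2" using R by (auto simp: r_def)
  have subx: "ball x (R/2) \<subseteq> U" if x: "x \<in> ball y (R/2)" for x
  proof -
    have "dist y w < R" if "dist x w < R/2" for w
      using x that dist_triangle[of y w x] by simp
    then show ?thesis using sub by auto
  qed
  have inU: "x + r *\<^sub>R z \<in> U" if "x \<in> ball y (R/2)" "z \<in> unit_box" for x z
    using r that by (intro scaled_unit_box_subset[of x r]) (auto intro!: set_mp[OF subx[of x]])
  define k where "k z = (- 1 / (r * integral unit_box (bump :: 'a \<Rightarrow> real))) * bump_deriv z v" for z
  have ck: "continuous_on S k" for S unfolding k_def by (intro continuous_intros)
  define G where "G x = integral unit_box (\<lambda>z. k z *\<^sub>R F' (x + r *\<^sub>R z))" for x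
  have rep: "F' x v = integral unit_box (\<lambda>z. k z *\<^sub>R F (x + r *\<^sub>R z))" if x: "x \<in> ball y (R/2)" for x
    unfolding laplace_field_derivative_formula[OF F U r subx[OF x]] integral_cmul[symmetric]
    by (simp add: k_def)
  have int: "(\<lambda>z. k z *\<^sub>R F' (x + r *\<^sub>R z)) integrable_on unit_box" if "x \<in> ball y (R/2)" for x
    using inU[OF that] by (intro integrable_continuous continuous_intros ck continuous_on_compose2[OF F']) auto
  have Gap: "G x u \<bullet> w = integral unit_box (\<lambda>z. k z * (F' (x + r *\<^sub>R z) u \<bullet> w))"
    and Gint: "(\<lambda>z. k z * (F' (x + r *\<^sub>R z) u \<bullet> w)) integrable_on unit_box"
    if x: "x \<in> ball y (R/2)" for x u w
  proof -
    have "(\<lambda>z. k z *\<^sub>R F' (x + r *\<^sub>R z) u) integrable_on unit_box"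
      using inU[OF x] by (intro integrable_continuous continuous_intros ck continuous_on_compose2[OF F']) auto
    moreover have "G x u = integral unit_box (\<lambda>z. k z *\<^sub>R F' (x + r *\<^sub>R z) u)"
      unfolding G_def using blinfun_apply_integral[OF int[OF x], of u] by (simp add: blinfun.scaleR_left)
    ultimately show "G x u \<bullet> w = integral unit_box (\<lambda>z. k z * (F' (x + r *\<^sub>R z) u \<bullet> w))"
      using integral_component_eq[of "\<lambda>z. k z *\<^sub>R F' (x + r *\<^sub>R z) u" unit_box w] by simp
    show "(\<lambda>z. k z * (F' (x + r *\<^sub>R z) u \<bullet> w)) integrable_on unit_box"
      using inU[OF x] by (intro integrable_continuous continuous_intros ck continuous_on_compose2[OF F']) auto
  qed
  have "laplace_field (ball y (R/2)) (\<lambda>x. F' x v) G"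
    unfolding laplace_field_def
  proof (intro conjI ballI allI)
    fix x assume x: "x \<in> ball y (R/2)"
    show "((\<lambda>x. F' x v) has_derivative G x) (at x)"
      unfolding G_def
      by (rule has_derivative_transform_within_open[OF
          has_derivative_weighted_average[OF F ck r subx[OF x]] open_ball x]) (simp add: rep)
    show "G x u \<bullet> w = u \<bullet> G x w" for u w
    proof -
      have "G x u \<bullet> w = G x w \<bullet> u" unfolding Gap[OF x]
        by (intro integral_cong) (metis inU[OF x] inner_commute sym)
      then show ?thesis by (simp add: inner_commute)
    qed
    have "(\<Sum>b\<in>Basis. G x b \<bullet> b) = integral unit_box (\<lambda>z. \<Sum>b\<in>Basis. k z * (F' (x + r *\<^sub>R z) b \<bullet> b))"
      unfolding Gap[OF x] by (intro integral_sum[symmetric] Gint x) auto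
    also have "\<dots> = integral unit_box (\<lambda>z::'a. 0::real)"
      by (intro integral_cong) (simp add: sum_distrib_left[symmetric] tr inU[OF x])
    finally show "(\<Sum>b\<in>Basis. G x b \<bullet> b) = 0" by simp
  next
    show "continuous_on (ball y (R/2)) G"
      unfolding G_def
      by (rule integral_continuous_on_param, unfold case_prod_unfold)
         (use inU in \<open>auto intro!: continuous_intros continuous_on_compose2[OF ck[of UNIV]] continuous_on_compose2[OF F']\<close>)
  qed
  then show "\<exists>e>0. \<exists>G'. laplace_field (ball y e) (\<lambda>x. F' x v) G'"
    using R half_gt_zero by blast
qed

text \<open>Repeated use of the preceding lemma. The choice runs over pairs of a field and its
  derivative, because the next field is read off from the derivative.\<close>

lemma laplace_field_directional_iterates:
  fixes F :: "'a::euclidean_space \<Rightarrow> 'a"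
  assumes F: "laplace_field U F F'" and U: "open U"
  obtains f f' where "f 0 = F" "\<And>n. laplace_field U (f n) (f' n)"
    "\<And>n. f (Suc n) = (\<lambda>x. blinfun_apply (f' n x) v)"
proof -
  have "\<exists>g. \<forall>n. (laplace_field U (fst (g n)) (snd (g n)) \<and> (n = 0 \<longrightarrow> fst (g n) = F)) \<and>
      fst (g (Suc n)) = (\<lambda>x. blinfun_apply (snd (g n) x) v)"
  proof (rule dependent_nat_choice)
    show "\<exists>h. laplace_field U (fst h) (snd h) \<and> (0 = (0::nat) \<longrightarrow> fst h = F)"
      using F by (intro exI[of _ "(F, F')"]) simp
  next
    fix h :: "('a \<Rightarrow> 'a) \<times> ('a \<Rightarrow> 'a \<Rightarrow>\<^sub>L 'a)" and n :: nat
    assume "laplace_field U (fst h) (snd h) \<and> (n = 0 \<longrightarrow> fst h = F)"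
    then obtain G' where "laplace_field U (\<lambda>x. blinfun_apply (snd h x) v) G'"
      using laplace_field_directional_derivative[OF _ U] by blast
    then show "\<exists>h'. (laplace_field U (fst h') (snd h') \<and> (Suc n = 0 \<longrightarrow> fst h' = F)) \<and>
        fst h' = (\<lambda>x. blinfun_apply (snd h x) v)"
      by (intro exI[of _ "(\<lambda>x. blinfun_apply (snd h x) v, G')"]) simp
  qed
  then obtain g where g: "\<And>n. laplace_field U (fst (g n)) (snd (g n))" "fst (g 0) = F"
      "\<And>n. fst (g (Suc n)) = (\<lambda>x. blinfun_apply (snd (g n) x) v)"
    by auto
  show thesis by (rule that[of "\<lambda>n. fst (g n)" "\<lambda>n. snd (g n)"]) (use g in auto)
qed

section \<open>Vanishing near a point where all derivatives vanish\<close>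

text \<open>The quotient of \<open>n ^ n\<close> by \<open>fact n\<close> is a single term of the
  exponential series at \<open>n\<close>. This weak Stirling bound absorbs the \<open>n ^ n\<close>
  that iterated Cauchy estimates produce.\<close>

lemma power_self_le_exp_fact: "real n ^ n \<le> exp (real n) * fact n"
proof -
  have s: "(\<lambda>k. real n ^ k /\<^sub>R fact k) sums exp (real n)" by (rule exp_converges)
  have "sum (\<lambda>k. real n ^ k /\<^sub>R fact k) {n} \<le> exp (real n)"
    using sum_le_suminf[OF sums_summable[OF s], of "{n}"] sums_unique[OF s] by simp
  then show ?thesis by (simp add: field_simps)
qed

text \<open>In the Taylor expansion along the segment from \<open>p\<close> to \<open>p + v\<close>
  only the remainder survives. Iterated Cauchy estimates bound it by \<open>M\<close> times the
  \<open>n\<close>-th power of \<open>2 * exp 1 * C * norm v / R\<close>, and the last hypothesis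
  makes this ratio at most 1/2.\<close>

lemma laplace_field_eq_zero_of_flat_direction:
  fixes f :: "nat \<Rightarrow> 'a::euclidean_space \<Rightarrow> 'a" and f' :: "nat \<Rightarrow> 'a \<Rightarrow> 'a \<Rightarrow>\<^sub>L 'a"
  assumes U: "open U" and lap: "\<And>n. laplace_field U (f n) (f' n)"
    and rec: "\<And>n. f (Suc n) = (\<lambda>x. blinfun_apply (f' n x) v)" and flat: "\<And>n. f n p = 0"
    and R: "R > 0" and sub: "ball p R \<subseteq> U"
    and M: "\<And>x. x \<in> ball p R \<Longrightarrow> norm (f 0 x) \<le> M"
    and v2: "norm v < R / 2" and v: "4 * exp 1 * cauchy_constant TYPE('a) * norm v \<le> R"
  shows "f 0 (p + v) = 0"
proof -
  define C where "C = cauchy_constant TYPE('a)"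
  have C: "C > 0" unfolding C_def by (rule cauchy_constant_pos)
  note v = v[folded C_def] and bound = laplace_field_derivative_bound[where 'a = 'a, folded C_def]
  have M0: "M \<ge> 0" using R by (intro order_trans[OF norm_ge_zero M[of p]]) simp
  have q: "2 * exp 1 * C * norm v / R \<le> 1/2" using v R by (simp add: field_simps)
  \<comment> \<open>Each further derivative costs a width \<open>\<delta>\<close> of the ball and a
    factor \<open>C * norm v / \<delta>\<close>.\<close>
  have iter: "norm (f n x) \<le> (C * norm v / \<delta>) ^ n * M"
    if \<delta>: "\<delta> > 0" and x: "x \<in> ball p (R - n * \<delta>)" for n \<delta> x
    using x
  proof (induction n arbitrary: x)
    case 0
    then show ?case using M by simp
  next
    case (Suc n)
    have xb: "ball x \<delta> \<subseteq> ball p (R - n * \<delta>)"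
    proof
      fix w assume "w \<in> ball x \<delta>"
      with Suc.prems dist_triangle[of p w x] show "w \<in> ball p (R - n * \<delta>)"
        by (simp add: algebra_simps)
    qed
    have "ball p (R - n * \<delta>) \<subseteq> ball p R" using \<delta> by (intro subset_ball) simp
    then have "ball x \<delta> \<subseteq> U" using xb sub by blast
    then have "norm (f' n x v) \<le> C * norm v / \<delta> * ((C * norm v / \<delta>) ^ n * M)"
      using xb Suc.IH by (intro bound[OF lap U \<delta>]) auto
    then show ?case by (simp add: rec mult.assoc)
  qed
  have small: "\<bar>f 0 (p + v) \<bullet> b\<bar> \<le> (1/2) ^ n * M" if b: "b \<in> Basis" and n: "n > 0" for n b
  proof -
    have inb: "p + t *\<^sub>R v \<in> ball p (R / 2)" if "0 \<le> t" "t \<le> 1" for t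
    proof -
      have "t * norm v \<le> 1 * norm v" using that by (intro mult_right_mono) auto
      with v2 that show ?thesis by (simp add: dist_norm)
    qed
    have inU: "p + t *\<^sub>R v \<in> U" if "0 \<le> t" "t \<le> 1" for t
      using inb[OF that] sub R by auto
    \<comment> \<open>The Lagrange remainder is a statement about real functions, so the expansion
      is made for each component separately.\<close>
    have "\<exists>t. 0 < t \<and> t \<le> 1 \<and> f 0 (p + 1 *\<^sub>R v) \<bullet> b =
        (\<Sum>m<n. (f m (p + 0 *\<^sub>R v) \<bullet> b) / fact m * 1 ^ m) + (f n (p + t *\<^sub>R v) \<bullet> b) / fact n * 1 ^ n"
    proof (rule Maclaurin2[where diff = "\<lambda>m t. f m (p + t *\<^sub>R v) \<bullet> b" and f = "\<lambda>t. f 0 (p + t *\<^sub>R v) \<bullet> b"])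
      show "\<forall>m t. m < n \<and> 0 \<le> t \<and> t \<le> 1 \<longrightarrow>
        ((\<lambda>t. f m (p + t *\<^sub>R v) \<bullet> b) has_real_derivative f (Suc m) (p + t *\<^sub>R v) \<bullet> b) (at t)"
      proof (intro allI impI)
        fix m and t :: real assume "m < n \<and> 0 \<le> t \<and> t \<le> 1"
        then have "p + t *\<^sub>R v \<in> U" using inU by blast
        then have d: "(f m has_derivative f' m (p + t *\<^sub>R v)) (at (p + t *\<^sub>R v))"
          using lap[of m] by (simp add: laplace_field_def)
        have "((\<lambda>t. p + t *\<^sub>R v) has_derivative (\<lambda>h. h *\<^sub>R v)) (at t)"
          by (auto intro!: derivative_eq_intros)
        from has_derivative_inner_left[OF has_derivative_compose[OF this d], of b]
        show "((\<lambda>t. f m (p + t *\<^sub>R v) \<bullet> b) has_real_derivative f (Suc m) (p + t *\<^sub>R v) \<bullet> b) (at t)"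
          unfolding has_field_derivative_def
          by (rule has_derivative_eq_rhs) (simp add: fun_eq_iff blinfun.scaleR_right rec)
      qed
    qed simp_all
    then obtain t where t: "0 < t" "t \<le> 1" "f 0 (p + v) \<bullet> b = (f n (p + t *\<^sub>R v) \<bullet> b) / fact n"
      by (auto simp: flat)
    have "\<bar>f n (p + t *\<^sub>R v) \<bullet> b\<bar> \<le> norm (f n (p + t *\<^sub>R v))" using b by (rule Basis_le_norm)
    \<comment> \<open>The width \<open>R / (2 * n)\<close> lets \<open>n\<close> estimates use up
      exactly half of the radius, leaving \<open>ball p (R / 2)\<close>, which contains the
      segment.\<close>
    also have "\<dots> \<le> (C * norm v / (R / (2 * n))) ^ n * M"
      using inb[of t] t n R by (intro iter) (auto simp: field_simps)
    also have "(C * norm v / (R / (2 * n))) ^ n = (2 * C * norm v / R) ^ n * real n ^ n"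
      by (subst power_mult_distrib[symmetric]) (simp add: mult_ac)
    also have "\<dots> * M \<le> (2 * C * norm v / R) ^ n * (exp (real n) * fact n) * M"
      using C R M0 by (intro mult_right_mono mult_left_mono power_self_le_exp_fact) auto
    also have "\<dots> = (2 * exp 1 * C * norm v / R) ^ n * M * fact n"
      by (simp add: exp_of_nat_mult[of n 1, simplified] power_mult_distrib power_divide mult_ac)
    also have "\<dots> \<le> (1/2) ^ n * M * fact n"
      using q C R M0 by (intro mult_right_mono power_mono) auto
    finally show ?thesis unfolding t(3) by (simp add: divide_le_eq)
  qed
  have "f 0 (p + v) \<bullet> b = 0" if b: "b \<in> Basis" for b
  proof -
    have "(\<lambda>n. (1/2::real) ^ n * M) \<longlonglongrightarrow> 0"
      by (intro tendsto_mult_left_zero LIMSEQ_power_zero) simp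
    then have "\<bar>f 0 (p + v) \<bullet> b\<bar> \<le> 0"
      by (rule LIMSEQ_le_const) (use small[OF b] in \<open>auto intro!: exI[of _ 1]\<close>)
    then show ?thesis by simp
  qed
  then show ?thesis by (simp add: euclidean_eq_iff[where 'a = 'a])
qed

text \<open>Applying \<open>step\<close> repeatedly makes all iterated derivatives in the direction
  \<open>x - p\<close> vanish on \<open>T\<close>, in particular at \<open>p\<close>. The iterates
  depend on the direction, but the admissible radius does not.\<close>

lemma laplace_field_eq_zero_near_flat_point:
  fixes F :: "'a::euclidean_space \<Rightarrow> 'a"
  assumes F: "laplace_field U F F'" and U: "open U" and p: "p \<in> T" "T \<subseteq> U"
    and zero: "\<And>x. x \<in> T \<Longrightarrow> F x = 0"
    and step: "\<And>G G' x. laplace_field U G G' \<Longrightarrow> (\<And>y. y \<in> T \<Longrightarrow> G y = 0) \<Longrightarrow> x \<in> T \<Longrightarrow> G' x = 0"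
  obtains e where "e > 0" "\<And>x. x \<in> ball p e \<Longrightarrow> F x = 0"
proof -
  define C where "C = cauchy_constant TYPE('a)"
  have C: "C > 0" unfolding C_def by (rule cauchy_constant_pos)
  \<comment> \<open>The two entries are the two smallness conditions of the preceding lemma on
    \<open>norm v\<close>, divided by \<open>R\<close>.\<close>
  define \<kappa> where "\<kappa> = min (1/2) (1 / (4 * exp 1 * C))"
  have \<kappa>: "\<kappa> > 0" using C by (simp add: \<kappa>_def)
  obtain R where R: "R > 0" "cball p R \<subseteq> U"
    using U p open_contains_cball by blast
  have "compact (F ` cball p R)"
    by (intro compact_continuous_image continuous_on_subset[OF laplace_field_continuous_on[OF F] R(2)]
        compact_cball)
  then obtain M where M: "\<And>x. x \<in> cball p R \<Longrightarrow> norm (F x) \<le> M"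
    using compact_imp_bounded bounded_iff by (metis image_eqI)
  have "F x = 0" if x: "x \<in> ball p (\<kappa> * R)" for x
  proof -
    obtain f f' where f: "f 0 = F" "\<And>n. laplace_field U (f n) (f' n)"
      "\<And>n. f (Suc n) = (\<lambda>y. blinfun_apply (f' n y) (x - p))"
      using laplace_field_directional_iterates[OF F U, of "x - p"] by blast
    have flat: "f n y = 0" if "y \<in> T" for n y
      using that
    proof (induction n arbitrary: y)
      case 0
      then show ?case by (simp add: f zero)
    next
      case (Suc n)
      then have "f' n y = 0" using step[OF f(2)[of n]] by blast
      then show ?case by (simp add: f)
    qed
    have "f 0 (p + (x - p)) = 0"
    proof (rule laplace_field_eq_zero_of_flat_direction[where f = f and f' = f' and p = p
          and R = R and M = M and v = "x - p" and U = U, OF U f(2,3) flat[OF p(1)] R(1)])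
      have "norm (x - p) < \<kappa> * R" using x by (simp add: dist_norm norm_minus_commute)
      moreover have "\<kappa> * R \<le> 1/2 * R" "\<kappa> * R \<le> 1 / (4 * exp 1 * C) * R"
        using R(1) by (intro mult_right_mono; simp add: \<kappa>_def)+
      ultimately have n: "norm (x - p) < 1/2 * R" "norm (x - p) \<le> 1 / (4 * exp 1 * C) * R"
        by linarith+
      from n(1) show "norm (x - p) < R / 2" by simp
      from n(2) show "4 * exp 1 * cauchy_constant TYPE('a) * norm (x - p) \<le> R"
        unfolding C_def[symmetric] using C by (simp add: field_simps)
      show "ball p R \<subseteq> U" using R(2) ball_subset_cball by blast
      show "norm (f 0 y) \<le> M" if "y \<in> ball p R" for y using that M f(1) by simp
    qed
    then show ?thesis by (simp add: f)
  qed
  with \<kappa> R(1) show thesis by (intro that[of "\<kappa> * R"]) auto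
qed

section \<open>Linear algebra on the tangent plane\<close>

text \<open>By symmetry the range of \<open>A\<close> is orthogonal to \<open>s\<close> and
  \<open>t\<close>, hence spanned by their cross product \<open>n\<close>. So \<open>A\<close> is a
  multiple of the projection onto \<open>n\<close>, and its trace is that multiple.\<close>

lemma symmetric_traceless_eq_zero_of_two_kernel_vectors:
  fixes A :: "(real^3) \<Rightarrow>\<^sub>L (real^3)"
  assumes sym: "\<And>u w. A u \<bullet> w = u \<bullet> A w" and tr: "(\<Sum>b\<in>Basis. A b \<bullet> b) = 0"
    and ker: "A s = 0" "A t = 0"
    and indep: "\<And>a b. a *\<^sub>R s + b *\<^sub>R t = 0 \<Longrightarrow> a = 0 \<and> b = 0"
  shows "A = 0"
proof -
  define n where "n = cross3 s t"
  have "n \<noteq> 0"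
  proof
    assume "n = 0"
    then consider "s = 0" | "t = 0" | c where "t = c *\<^sub>R s"
      by (auto simp: n_def cross_eq_0 collinear_lemma)
    then show False
    proof cases
      case 1
      then show False using indep[of 1 0] by simp
    next
      case 2
      then show False using indep[of 0 1] by simp
    next
      case 3
      then show False using indep[of c "-1"] by simp
    qed
  qed
  then have nn: "n \<bullet> n \<noteq> 0" by simp
  have par: "(n \<bullet> n) *\<^sub>R A u = (A u \<bullet> n) *\<^sub>R n" for u
  proof -
    \<comment> \<open>Lagrange's formula expands this into multiples of \<open>s\<close> and
      \<open>t\<close> with coefficients \<open>A u \<bullet> t\<close> and
      \<open>A u \<bullet> s\<close> up to sign; both are 0 by symmetry. A second expansion, of the
      product with \<open>n\<close>, gives the claim.\<close>
    have "cross3 (A u) n = 0"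
      by (simp add: n_def Lagrange sym ker)
    then have "cross3 n (cross3 (A u) n) = 0" by simp
    then show ?thesis by (simp add: Lagrange inner_commute)
  qed
  have rank1: "(n \<bullet> n)\<^sup>2 * (A u \<bullet> w) = (A n \<bullet> n) * (u \<bullet> n) * (n \<bullet> w)" for u w
  proof -
    have 1: "(n \<bullet> n) * (A u \<bullet> w) = (A u \<bullet> n) * (n \<bullet> w)" for u w
      using arg_cong[OF par[of u], of "\<lambda>x. x \<bullet> w"] by simp
    have "(n \<bullet> n) * (A u \<bullet> n) = (n \<bullet> n) * (A n \<bullet> u)" by (metis sym inner_commute)
    also have "\<dots> = (A n \<bullet> n) * (u \<bullet> n)" using 1[of n u] by (simp add: inner_commute)
    finally have 2: "(n \<bullet> n) * (A u \<bullet> n) = (A n \<bullet> n) * (u \<bullet> n)" .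
    have "(n \<bullet> n)\<^sup>2 * (A u \<bullet> w) = ((n \<bullet> n) * (A u \<bullet> n)) * (n \<bullet> w)"
      unfolding power2_eq_square by (simp add: 1 mult.assoc)
    then show ?thesis by (simp only: 2)
  qed
  have diag: "(n \<bullet> n)\<^sup>2 * (A b \<bullet> b) = (A n \<bullet> n) * ((n \<bullet> b) * (n \<bullet> b))" for b
    using rank1[of b b] by (simp add: inner_commute mult.assoc)
  have "0 = (n \<bullet> n)\<^sup>2 * (\<Sum>b\<in>Basis. A b \<bullet> b)" using tr by simp
  also have "\<dots> = (\<Sum>b\<in>Basis. (A n \<bullet> n) * ((n \<bullet> b) * (n \<bullet> b)))"
    unfolding sum_distrib_left by (intro sum.cong refl) (rule diag)
  also have "\<dots> = (A n \<bullet> n) * (n \<bullet> n)"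
    by (simp only: sum_distrib_left[symmetric] euclidean_inner[symmetric])
  finally have "A n \<bullet> n = 0" using nn by simp
  then have "A u \<bullet> w = 0" for u w using rank1[of u w] nn by simp
  then have "A u = 0" for u by (metis inner_eq_zero_iff)
  then show ?thesis by (intro blinfun_eqI) simp
qed

lemma symmetric_of_symmetric_on_Basis:
  fixes A :: "'a::euclidean_space \<Rightarrow> 'a"
  assumes A: "linear A" and sym: "\<And>i j. i \<in> Basis \<Longrightarrow> j \<in> Basis \<Longrightarrow> A i \<bullet> j = A j \<bullet> i"
  shows "A u \<bullet> w = u \<bullet> A w"
proof -
  have "A u \<bullet> w = (\<Sum>j\<in>Basis. \<Sum>i\<in>Basis. (u \<bullet> i) * (A i \<bullet> j) * (w \<bullet> j))"
    by (subst euclidean_inner) (simp add: Linear_Algebra.linear_componentwise[OF A, of u] sum_distrib_right)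
  also have "\<dots> = (\<Sum>i\<in>Basis. \<Sum>j\<in>Basis. (u \<bullet> i) * ((w \<bullet> j) * (A j \<bullet> i)))"
    by (subst sum.swap) (auto intro!: sum.cong simp: sym)
  also have "\<dots> = u \<bullet> A w"
    by (subst euclidean_inner[of u]) (simp add: Linear_Algebra.linear_componentwise[OF A, of w] sum_distrib_left)
  finally show ?thesis .
qed

section \<open>Divergence- and curl-free fields on a surface patch\<close>

text \<open>The curl collects the antisymmetric part of the derivative and the divergence is its
  trace. In finite dimension, continuity of every directional derivative gives continuity in the
  operator norm.\<close>

lemma laplace_field_of_div_curl_free:
  fixes H :: "real^3 \<Rightarrow> real^3"
  assumes C1: "C1_on U H" and div: "\<forall>x\<in>U. div3 H x = 0" and curl: "\<forall>x\<in>U. curl3 H x = 0"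
  shows "laplace_field U H (\<lambda>x. Blinfun (frechet_derivative H (at x)))"
proof -
  define D where "D x = frechet_derivative H (at x)" for x
  have der: "(H has_derivative D x) (at x)" if "x \<in> U" for x
    using C1 that unfolding C1_on_def D_def by (simp add: frechet_derivative_works[symmetric])
  have ap: "blinfun_apply (Blinfun (D x)) = D x" if "x \<in> U" for x
    using der[OF that] by (intro bounded_linear_Blinfun_apply has_derivative_bounded_linear)
  have cont: "continuous_on U (\<lambda>x. D x v)" for v
    using C1 by (simp add: C1_on_def D_def)
  have symax: "D x (axis i 1) $ j = D x (axis j 1) $ i" if x: "x \<in> U" for x i j
  proof -
    have "curl3 H x $ 1 = 0" "curl3 H x $ 2 = 0" "curl3 H x $ 3 = 0" using curl x by simp_all
    then have "pd H 3 2 x = pd H 2 3 x" "pd H 1 3 x = pd H 3 1 x" "pd H 2 1 x = pd H 1 2 x"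
      by (simp_all add: curl3_def)
    then show ?thesis
      using exhaust_3[of i] exhaust_3[of j] by (auto simp: pd_def D_def)
  qed
  have Bas: "(Basis :: (real^3) set) = range (\<lambda>i. axis i 1)"
    by (auto simp: Basis_vec_def)
  have inj: "inj (\<lambda>i::3. axis i (1::real))"
    by (auto simp: inj_def axis_eq_axis)
  show ?thesis
    unfolding laplace_field_def D_def[symmetric]
  proof (intro conjI ballI allI)
    fix x assume x: "x \<in> U"
    show "(H has_derivative Blinfun (D x)) (at x)" using der[OF x] ap[OF x] by simp
    show "Blinfun (D x) u \<bullet> w = u \<bullet> Blinfun (D x) w" for u w
      unfolding ap[OF x]
      by (rule symmetric_of_symmetric_on_Basis[OF has_derivative_linear[OF der[OF x]]])
         (auto simp: Bas inner_axis symax[OF x])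
    have "(\<Sum>b\<in>Basis. D x b \<bullet> b) = (\<Sum>i\<in>UNIV. D x (axis i 1) $ i)"
      unfolding Bas by (subst sum.reindex[OF inj]) (simp add: inner_axis)
    also have "\<dots> = div3 H x" by (simp add: sum_3 div3_def pd_def D_def)
    finally show "(\<Sum>b\<in>Basis. Blinfun (D x) b \<bullet> b) = 0"
      using div x by (simp add: ap)
  next
    show "continuous_on U (\<lambda>x. Blinfun (D x))"
      by (rule continuous_on_blinfun_componentwise)
         (use cont in \<open>simp add: ap cong: continuous_on_cong\<close>)
  qed
qed

text \<open>By the chain rule \<open>F' (\<phi> u)\<close> annihilates both partial derivatives of
  \<open>\<phi>\<close>, since \<open>F\<close> composed with \<open>\<phi>\<close> is 0 near
  \<open>u\<close>. Stated for any field vanishing on the patch, so that it also covers the iterated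
  derivatives.\<close>

lemma laplace_field_derivative_zero_on_immersed_surface:
  fixes F :: "real^3 \<Rightarrow> real^3" and \<phi> :: "real^2 \<Rightarrow> real^3"
  assumes F: "laplace_field \<Omega> F F'" and U: "open U" "u \<in> U" and sub: "\<phi> ` U \<subseteq> \<Omega>"
    and \<phi>: "\<phi> differentiable (at u)" and zero: "\<And>y. y \<in> \<phi> ` U \<Longrightarrow> F y = 0"
    and indep: "\<And>a b. a *\<^sub>R frechet_derivative \<phi> (at u) (axis 1 1)
          + b *\<^sub>R frechet_derivative \<phi> (at u) (axis 2 1) = 0 \<Longrightarrow> a = 0 \<and> b = 0"
  shows "F' (\<phi> u) = 0"
proof -
  have \<phi>u: "\<phi> u \<in> \<Omega>" using U sub by blast
  have "(\<phi> has_derivative frechet_derivative \<phi> (at u)) (at u)"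
    using \<phi> by (simp add: frechet_derivative_works[symmetric])
  moreover have "(F has_derivative F' (\<phi> u)) (at (\<phi> u))"
    using F \<phi>u by (simp add: laplace_field_def)
  ultimately have "((\<lambda>w. F (\<phi> w)) has_derivative (\<lambda>h. F' (\<phi> u) (frechet_derivative \<phi> (at u) h))) (at u)"
    by (rule has_derivative_compose)
  then have "((\<lambda>w. 0) has_derivative (\<lambda>h. F' (\<phi> u) (frechet_derivative \<phi> (at u) h))) (at u)"
    by (rule has_derivative_transform_within_open[OF _ U]) (simp add: zero)
  from has_derivative_unique[OF this has_derivative_const]
  have ker: "F' (\<phi> u) (frechet_derivative \<phi> (at u) h) = 0" for h by (rule fun_cong)
  show ?thesis
    by (rule symmetric_traceless_eq_zero_of_two_kernel_vectors[OF _ _ ker ker indep])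
       (use F \<phi>u in \<open>auto simp: laplace_field_def\<close>)
qed

theorem theorem2p1:
  fixes \<Omega> :: "(real^3) set" and H :: "real^3 \<Rightarrow> real^3"
  assumes "open \<Omega>" and "connected \<Omega>" and "\<Omega> \<noteq> {}"
    and "C1_on \<Omega> H"
    and "\<forall>x\<in>\<Omega>. div3 H x = 0"
    and "\<forall>x\<in>\<Omega>. curl3 H x = 0"
  shows "\<forall>c::real^3. \<not> regular_surface_in \<Omega> {x\<in>\<Omega>. H x = c}"
proof (intro allI notI)
  fix c :: "real^3"
  define S where "S = {x\<in>\<Omega>. H x = c}"
  assume "regular_surface_in \<Omega> {x\<in>\<Omega>. H x = c}"
  then obtain p where pS: "p \<in> S" and ex: "\<exists>V U (\<phi>::real^2 \<Rightarrow> real^3) \<psi>.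
        open V \<and> p \<in> V \<and> open U \<and> C1_on U \<phi> \<and> homeomorphism U (S \<inter> V) \<phi> \<psi> \<and>
        (\<forall>u\<in>U. \<forall>a b::real. a *\<^sub>R frechet_derivative \<phi> (at u) (axis 1 1)
          + b *\<^sub>R frechet_derivative \<phi> (at u) (axis 2 1) = 0 \<longrightarrow> a = 0 \<and> b = 0)"
    unfolding regular_surface_in_def S_def by blast
  from ex obtain V U and \<phi> :: "real^2 \<Rightarrow> real^3" and \<psi> where V: "open V" "p \<in> V" and U: "open U"
    and C1: "C1_on U \<phi>" and hom: "homeomorphism U (S \<inter> V) \<phi> \<psi>"
    and indep: "\<And>u a b. u \<in> U \<Longrightarrow> a *\<^sub>R frechet_derivative \<phi> (at u) (axis 1 1)
          + b *\<^sub>R frechet_derivative \<phi> (at u) (axis 2 1) = 0 \<Longrightarrow> a = 0 \<and> b = 0"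
    by blast
  have im: "\<phi> ` U = S \<inter> V" using hom by (simp add: homeomorphism_def)
  have diff: "\<phi> differentiable (at u)" if "u \<in> U" for u
    using C1 that by (simp add: C1_on_def)
  define F where "F x = H x - c" for x
  define F' where "F' x = Blinfun (frechet_derivative H (at x))" for x
  have "laplace_field \<Omega> H F'"
    unfolding F'_def using assms by (intro laplace_field_of_div_curl_free)
  then have F: "laplace_field \<Omega> F F'"
    unfolding laplace_field_def F_def by (auto intro!: derivative_eq_intros)
  obtain e where e: "e > 0" "\<And>x. x \<in> ball p e \<Longrightarrow> F x = 0"
  \<comment> \<open>The set \<open>T\<close> is the whole patch and not just \<open>p\<close>:
    passing from one derivative to the next requires differentiating along the patch.\<close>
  proof (rule laplace_field_eq_zero_near_flat_point[OF F \<open>open \<Omega>\<close>])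
    show "p \<in> \<phi> ` U" using pS V im by simp
    show sub: "\<phi> ` U \<subseteq> \<Omega>" using im by (auto simp: S_def)
    show "F x = 0" if "x \<in> \<phi> ` U" for x using that im by (auto simp: F_def S_def)
    show "G' x = 0" if "laplace_field \<Omega> G G'" "\<And>y. y \<in> \<phi> ` U \<Longrightarrow> G y = 0" "x \<in> \<phi> ` U" for G G' x
    proof -
      obtain u where u: "u \<in> U" and x: "x = \<phi> u" using \<open>x \<in> \<phi> ` U\<close> by blast
      show ?thesis
        unfolding x
        by (rule laplace_field_derivative_zero_on_immersed_surface[OF
              that(1) U u sub diff[OF u] that(2) indep[OF u]])
    qed
  qed (rule that)
  \<comment> \<open>Intersecting with \<open>V\<close> and \<open>\<Omega>\<close> places every
    point of \<open>W\<close> in the level set and in the patch, so a nonempty open set lies inside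
    a negligible one.\<close>
  define W where "W = ball p e \<inter> V \<inter> \<Omega>"
  have "open W" "p \<in> W" using V \<open>open \<Omega>\<close> e pS by (auto simp: W_def S_def)
  moreover have "W \<subseteq> \<phi> ` U"
    unfolding im using e by (auto simp: W_def S_def F_def)
  moreover have "negligible (\<phi> ` U)"
    using diff by (intro negligible_differentiable_image_lowdim)
      (auto simp: differentiable_on_def intro: differentiable_at_withinI)
  ultimately show False
    using negligible_subset open_not_negligible by blast
qed

end
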